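(* Let $G$ be a profinite group, let $X$ be a profinite $G$-space, and let $F$ be a $G$-equivariant sheaf of sets over $X$. If $U$ is a compact open subset of $X$, then the set of sections $F(U)$ is a discrete $\mathrm{stab}_G(U)$-set.
   Context: A profinite space is a compact, Hausdorff, totally disconnected space; a profinite group is a topological group whose underlying space is profinite. A $G$-space is a topological space with a continuous left $G$-action. A $G$-equivariant sheaf of sets over a $G$-space $X$ is a $G$-equivariant local homeomorphism $p\colon E\to X$, where $E$ is a $G$-space. For $U\subseteq X$ open, $F(U)=\Gamma(U,E)$ is the set of all continuous (not necessarily equivariant) sections $s\colon U\to E$ of $p$. For $g\in G$ and $s\in F(U)$ let $g\ast s=g\circ s\circ g^{-1}\in F(gU)$. The group $\mathrm{stab}_G(U)=\{g\in G\mid gU=U\}$, with the subspace topology from $G$, acts on $F(U)$ by $(g,s)\mapsto g\ast s$. A set with an action of a topological group $H$ is a discrete $H$-set if the action is continuous when the set is given the discrete topology. *)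

theory Defs
  imports "HOL-Analysis.Analysis" "HOL-Algebra.Group_Action"
begin

definition profinite_space :: "'a topology \<Rightarrow> bool"
  where "profinite_space X \<longleftrightarrow>
    compact_space X \<and> Hausdorff_space X \<and> (\<forall>S. connectedin X S \<longrightarrow> (\<exists>a. S \<subseteq> {a}))"

locale topological_group = group G for G (structure) and T +
  assumes topspace_eq: "topspace T = carrier G"
    and continuous_mult: "continuous_map (prod_topology T T) T (\<lambda>(g, h). g \<otimes> h)"
    and continuous_inv: "continuous_map T T (\<lambda>g. inv g)"

definition profinite_group :: "('g, 'm) monoid_scheme \<Rightarrow> 'g topology \<Rightarrow> bool"
  where "profinite_group G T \<longleftrightarrow> topological_group G T \<and> profinite_space T"

text \<open>
  In \<^locale>\<open>group_action\<close> the maps \<^term>\<open>\<phi> g\<close> are extensional,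
  i.e. \<^const>\<open>undefined\<close> outside the underlying set. The same convention is
  used below for sections, so that equality of sections is equality on their domain.
\<close>

locale G_space = topological_group G T + group_action G "topspace X" \<phi>
  for G (structure) and T and X and \<phi> +
  assumes continuous_action: "continuous_map (prod_topology T X) X (\<lambda>(g, x). \<phi> g x)"

definition discrete_G_set ::
    "('g, 'm) monoid_scheme \<Rightarrow> 'g topology \<Rightarrow> 'a set \<Rightarrow> ('g \<Rightarrow> 'a \<Rightarrow> 'a) \<Rightarrow> bool"
  where "discrete_G_set G T S \<phi> \<longleftrightarrow> G_space G T (discrete_topology S) \<phi>"

definition local_homeomorphism :: "'e topology \<Rightarrow> 'x topology \<Rightarrow> ('e \<Rightarrow> 'x) \<Rightarrow> bool"
  where "local_homeomorphism E X p \<longleftrightarrow>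
    (\<forall>e \<in> topspace E. \<exists>V W. openin E V \<and> e \<in> V \<and> openin X W \<and>
       homeomorphic_map (subtopology E V) (subtopology X W) p)"

locale equivariant_sheaf =
  base: G_space G T X \<phi> + total: G_space G T E \<psi>
  for G (structure) and T and X and \<phi> and E and \<psi> +
  fixes p
  assumes local_homeo: "local_homeomorphism E X p"
    and equivariant: "\<lbrakk>g \<in> carrier G; e \<in> topspace E\<rbrakk> \<Longrightarrow> p (\<psi> g e) = \<phi> g (p e)"

definition sections :: "'x topology \<Rightarrow> 'e topology \<Rightarrow> ('e \<Rightarrow> 'x) \<Rightarrow> 'x set \<Rightarrow> ('x \<Rightarrow> 'e) set"
  where "sections X E p U =
    {s \<in> extensional U. continuous_map (subtopology X U) E s \<and> (\<forall>x\<in>U. p (s x) = x)}"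

definition section_act ::
    "('g, 'm) monoid_scheme \<Rightarrow> ('g \<Rightarrow> 'x \<Rightarrow> 'x) \<Rightarrow> ('g \<Rightarrow> 'e \<Rightarrow> 'e) \<Rightarrow>
     'x set \<Rightarrow> 'g \<Rightarrow> ('x \<Rightarrow> 'e) \<Rightarrow> 'x \<Rightarrow> 'e"
  where "section_act G \<phi> \<psi> U g s = (\<lambda>y \<in> \<phi> g ` U. \<psi> g (s (\<phi> (inv\<^bsub>G\<^esub> g) y)))"

definition setwise_stabilizer :: "('g, 'm) monoid_scheme \<Rightarrow> ('g \<Rightarrow> 'x \<Rightarrow> 'x) \<Rightarrow> 'x set \<Rightarrow> 'g set"
  where "setwise_stabilizer G \<phi> U = {g \<in> carrier G. \<phi> g ` U = U}"

end

theory Submission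
  imports Defs
begin

text \<open>
  For sections \<open>s\<close> and \<open>t\<close> over \<open>U\<close>, an element \<open>g\<close> of the stabilizer of \<open>U\<close> satisfies
  \<open>g * s = t\<close> iff the maps \<open>(g, x) \<mapsto> g (s x)\<close> and \<open>(g, x) \<mapsto> t (g x)\<close> agree on \<open>{g} \<times> U\<close>.
  Both maps lift \<open>(g, x) \<mapsto> g x\<close> along the local homeomorphism \<open>p\<close>, so they agree on an open set.
  As \<open>U\<close> is compact, the tube lemma shows that \<open>{g. g * s = t}\<close> is open.
\<close>

section \<open>Agreement sets of lifts and the tube lemma\<close>

text \<open>Local injectivity of \<open>p\<close> is the reason. Near a point of agreement both maps
  take values in one open set \<open>V\<close> on which \<open>p\<close> is injective, and there
  equality after applying \<open>p\<close> forces equality.\<close>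

lemma openin_lifts_agree:
  assumes p: "local_homeomorphism E X p"
    and a: "continuous_map Z E a" and b: "continuous_map Z E b"
    and eq: "\<And>z. z \<in> topspace Z \<Longrightarrow> p (a z) = p (b z)"
  shows "openin Z {z \<in> topspace Z. a z = b z}"
proof (subst openin_subopen, intro ballI)
  fix z assume "z \<in> {z \<in> topspace Z. a z = b z}"
  then have z: "z \<in> topspace Z" and ab: "a z = b z"
    by auto
  have "a z \<in> topspace E"
    using a z by (auto simp: continuous_map_def)
  then obtain V W where V: "openin E V" "a z \<in> V"
    and hom: "homeomorphic_map (subtopology E V) (subtopology X W) p"
    using p unfolding local_homeomorphism_def by blast
  have inj: "inj_on p V"
    using homeomorphic_imp_injective_map [OF hom] openin_subset [OF V(1)]
    by (simp add: inf.absorb2)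
  let ?N = "{z \<in> topspace Z. a z \<in> V} \<inter> {z \<in> topspace Z. b z \<in> V}"
  have "openin Z ?N"
    using a b V(1) by (intro openin_Int) (auto simp: continuous_map_def)
  moreover have "z \<in> ?N"
    using z ab V(2) by simp
  moreover have "?N \<subseteq> {z \<in> topspace Z. a z = b z}"
    using inj eq by (auto dest: inj_onD)
  ultimately show "\<exists>N. openin Z N \<and> z \<in> N \<and> N \<subseteq> {z \<in> topspace Z. a z = b z}"
    by blast
qed

text \<open>By the tube lemma, an open \<open>W\<close> containing \<open>{z} \<times> C\<close>
  contains \<open>N \<times> C\<close> for some neighbourhood \<open>N\<close> of \<open>z\<close>.
  This turns an open condition on pairs \<open>(g, x)\<close> into an open condition on
  \<open>g\<close> alone.\<close>

lemma openin_Ball_compactin: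
  assumes W: "openin (prod_topology Z X) W" and C: "compactin X C"
  shows "openin Z {z \<in> topspace Z. \<forall>x\<in>C. (z, x) \<in> W}"
proof (subst openin_subopen, intro ballI)
  fix z assume z: "z \<in> {z \<in> topspace Z. \<forall>x\<in>C. (z, x) \<in> W}"
  then have "z \<in> topspace Z" "{z} \<times> C \<subseteq> W"
    by auto
  from tube_lemma_right [OF W C this] obtain N V
    where "openin Z N" "z \<in> N" "C \<subseteq> V" "N \<times> V \<subseteq> W"
    by blast
  then show "\<exists>N. openin Z N \<and> z \<in> N \<and> N \<subseteq> {z \<in> topspace Z. \<forall>x\<in>C. (z, x) \<in> W}"
    using openin_subset by blast
qed

section \<open>Subgroups, group actions and discrete sets\<close>

lemma (in topological_group) topological_group_subgroup:
  assumes H: "subgroup H G"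
  shows "topological_group (G\<lparr>carrier := H\<rparr>) (subtopology T H)"
proof -
  have sub: "H \<subseteq> carrier G"
    using H by (rule subgroup.subset)
  have top: "topspace (subtopology T H) = H"
    using sub topspace_eq by auto
  have "continuous_map (prod_topology (subtopology T H) (subtopology T H)) T (\<lambda>(g, h). g \<otimes> h)"
    by (simp add: subtopology_Times [symmetric] continuous_map_from_subtopology continuous_mult)
  then have mult: "continuous_map (prod_topology (subtopology T H) (subtopology T H))
      (subtopology T H) (\<lambda>(g, h). g \<otimes> h)"
    using subgroup.m_closed [OF H] by (auto intro!: continuous_map_into_subtopology)
  have "continuous_map (subtopology T H) (subtopology T H) (\<lambda>g. inv g)"
    using subgroup.m_inv_closed [OF H] top
    by (intro continuous_map_into_subtopology continuous_map_from_subtopology continuous_inv) auto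
  \<comment> \<open>The inverse in the restricted group is a different term, known to agree with
    \<open>inv g\<close> only for \<open>g\<close> in \<open>H\<close>. Continuity is therefore
    carried over by equality on the topspace.\<close>
  then have inv: "continuous_map (subtopology T H) (subtopology T H) (\<lambda>g. inv\<^bsub>G\<lparr>carrier := H\<rparr>\<^esub> g)"
    by (rule continuous_map_eq) (use top H in auto)
  have "group (G\<lparr>carrier := H\<rparr>)"
    using H is_group by (rule subgroup.subgroup_is_group)
  then show ?thesis
    using top mult inv by (simp add: topological_group_def topological_group_axioms_def)
qed

lemma (in group_action) subgroup_setwise_stabilizer:
  assumes U: "U \<subseteq> E"
  shows "subgroup (setwise_stabilizer G \<phi> U) G"
proof -
  interpret group G
    using group_hom by (rule group_hom.axioms)
  show ?thesis
  proof (rule subgroupI)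
    show "setwise_stabilizer G \<phi> U \<subseteq> carrier G"
      by (auto simp: setwise_stabilizer_def)
    have "\<phi> \<one> ` U = U"
      using U by (auto simp: id_eq_one [symmetric] image_def)
    then show "setwise_stabilizer G \<phi> U \<noteq> {}"
      by (auto simp: setwise_stabilizer_def)
  next
    fix g assume "g \<in> setwise_stabilizer G \<phi> U"
    then have g: "g \<in> carrier G" and gU: "\<phi> g ` U = U"
      by (auto simp: setwise_stabilizer_def)
    have "\<phi> (inv g) (\<phi> g x) = x" if "x \<in> U" for x
      using orbit_sym_aux [OF g _ refl] that U by blast
    then have "\<phi> (inv g) ` (\<phi> g ` U) = U"
      by (simp add: image_image)
    with g gU show "inv g \<in> setwise_stabilizer G \<phi> U"
      by (simp add: setwise_stabilizer_def)
  next
    fix g h assume "g \<in> setwise_stabilizer G \<phi> U" "h \<in> setwise_stabilizer G \<phi> U"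
    then have g: "g \<in> carrier G" "\<phi> g ` U = U" and h: "h \<in> carrier G" "\<phi> h ` U = U"
      by (auto simp: setwise_stabilizer_def)
    have "\<phi> (g \<otimes> h) ` U = (\<lambda>x. \<phi> g (\<phi> h x)) ` U"
      using U g h by (intro image_cong) (auto simp: composition_rule)
    also have "\<dots> = U"
      using g h by (simp add: image_image [symmetric])
    finally show "g \<otimes> h \<in> setwise_stabilizer G \<phi> U"
      using g h by (simp add: setwise_stabilizer_def)
  qed
qed

text \<open>Bijectivity is automatic, since \<open>\<phi> (inv g)\<close> is a two-sided inverse of
  \<open>\<phi> g\<close> on \<open>S\<close>. Extensionality upgrades the pointwise law
  \<open>mult\<close> to the equality of functions that a homomorphism into
  \<open>BijGroup S\<close> demands.\<close>

lemma (in group) group_actionI: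
  assumes ext: "\<And>g. g \<in> carrier G \<Longrightarrow> \<phi> g \<in> extensional S"
    and closed: "\<And>g x. \<lbrakk>g \<in> carrier G; x \<in> S\<rbrakk> \<Longrightarrow> \<phi> g x \<in> S"
    and one: "\<And>x. x \<in> S \<Longrightarrow> \<phi> \<one> x = x"
    and mult: "\<And>g h x. \<lbrakk>g \<in> carrier G; h \<in> carrier G; x \<in> S\<rbrakk> \<Longrightarrow> \<phi> (g \<otimes> h) x = \<phi> g (\<phi> h x)"
  shows "group_action G S \<phi>"
proof -
  have Bij: "\<phi> g \<in> Bij S" if g: "g \<in> carrier G" for g
  proof -
    have "bij_betw (\<phi> g) S S"
    proof (rule bij_betw_byWitness [where f' = "\<phi> (inv g)"])
      show "\<forall>x\<in>S. \<phi> (inv g) (\<phi> g x) = x"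
        using g by (simp add: mult [symmetric] one)
      show "\<forall>x\<in>S. \<phi> g (\<phi> (inv g) x) = x"
        using g by (simp add: mult [symmetric] one)
      show "\<phi> g ` S \<subseteq> S" "\<phi> (inv g) ` S \<subseteq> S"
        using g closed by auto
    qed
    then show ?thesis
      using ext g by (simp add: Bij_def)
  qed
  have "\<phi> (g \<otimes> h) = compose S (\<phi> g) (\<phi> h)" if "g \<in> carrier G" "h \<in> carrier G" for g h
    by (rule extensionalityI [where A = S]) (use that ext mult in \<open>auto simp: compose_eq\<close>)
  then have "\<phi> \<in> hom G (BijGroup S)"
    using Bij by (auto simp: hom_def BijGroup_def)
  then show ?thesis
    by (simp add: group_action_def group_hom_def group_hom_axioms_def group_BijGroup is_group)
qed

text \<open>Joint continuity reduces to open fibres because singletons are open in the discrete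
  factor: the preimage of \<open>Q\<close> is a union of open rectangles, each a fibre times
  \<open>{s}\<close>.\<close>

lemma discrete_G_setI:
  assumes "topological_group G T" and act: "group_action G S \<phi>"
    and fibre: "\<And>s t. \<lbrakk>s \<in> S; t \<in> S\<rbrakk> \<Longrightarrow> openin T {g \<in> carrier G. \<phi> g s = t}"
  shows "discrete_G_set G T S \<phi>"
proof -
  interpret topological_group G T by fact
  have "openin (prod_topology T (discrete_topology S)) {z \<in> carrier G \<times> S. case_prod \<phi> z \<in> Q}"
    if Q: "Q \<subseteq> S" for Q
  proof -
    have "openin (prod_topology T (discrete_topology S)) ({g \<in> carrier G. \<phi> g s = t} \<times> {s})"
      if "s \<in> S" "t \<in> Q" for s t
      using fibre that Q by (auto simp: openin_prod_Times_iff)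
    then have "openin (prod_topology T (discrete_topology S))
        (\<Union>(s, t)\<in>S \<times> Q. {g \<in> carrier G. \<phi> g s = t} \<times> {s})"
      by (intro openin_Union) auto
    moreover have "{z \<in> carrier G \<times> S. case_prod \<phi> z \<in> Q} =
        (\<Union>(s, t)\<in>S \<times> Q. {g \<in> carrier G. \<phi> g s = t} \<times> {s})"
      by auto
    ultimately show ?thesis
      by metis
  qed
  then have "continuous_map (prod_topology T (discrete_topology S)) (discrete_topology S)
      (\<lambda>(g, s). \<phi> g s)"
    using group_action.element_image [OF act]
    by (auto simp: continuous_map_def topspace_eq)
  then show ?thesis
    using assms(1) act
    by (simp add: discrete_G_set_def G_space_def G_space_axioms_def)
qed

section \<open>The stabilizer acting on sections\<close>

context equivariant_sheaf
begin

lemma section_act_apply: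
  assumes "g \<in> setwise_stabilizer G \<phi> U" "y \<in> U"
  shows "section_act G \<phi> \<psi> U g s y = \<psi> g (s (\<phi> (inv g) y))"
  using assms by (simp add: section_act_def setwise_stabilizer_def)

text \<open>Continuity holds because the new map is a composite of translation by
  \<open>inv g\<close>, the section \<open>s\<close> and translation by \<open>g\<close>. It is a
  section since equivariance gives p(g s(g^-1 y)) = g p(s(g^-1 y)) = g g^-1 y = y.\<close>

lemma section_act_in_sections:
  assumes U: "U \<subseteq> topspace X" and g: "g \<in> setwise_stabilizer G \<phi> U"
    and s: "s \<in> sections X E p U"
  shows "section_act G \<phi> \<psi> U g s \<in> sections X E p U"
proof -
  have g': "g \<in> carrier G" "\<phi> g ` U = U"
    using g by (auto simp: setwise_stabilizer_def)
  have "inv g \<in> setwise_stabilizer G \<phi> U"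
    using base.subgroup_setwise_stabilizer [OF U] g by (rule subgroup.m_inv_closed)
  then have ig: "inv g \<in> carrier G" "\<phi> (inv g) ` U = U"
    by (auto simp: setwise_stabilizer_def)
  have s': "continuous_map (subtopology X U) E s" "\<And>x. x \<in> U \<Longrightarrow> p (s x) = x"
    using s by (auto simp: sections_def)
  have topU: "topspace (subtopology X U) = U"
    using U by auto
  have sE: "s x \<in> topspace E" if "x \<in> U" for x
    using s'(1) that topU by (auto simp: continuous_map_def)
  \<comment> \<open>A single translation is the joint action precomposed with
    \<open>x \<mapsto> (inv g, x)\<close>.\<close>
  have "continuous_map X X (\<phi> (inv g))"
    using continuous_map_compose [OF _ base.continuous_action, of X "\<lambda>x. (inv g, x)"] ig
    by (simp add: o_def continuous_map_pairedI base.topspace_eq)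
  then have "continuous_map (subtopology X U) (subtopology X U) (\<phi> (inv g))"
    using ig topU by (intro continuous_map_into_subtopology continuous_map_from_subtopology) auto
  from continuous_map_compose [OF this s'(1)]
  have "continuous_map (subtopology X U) E (\<lambda>y. s (\<phi> (inv g) y))"
    by (simp add: o_def)
  then have "continuous_map (subtopology X U) E (\<lambda>y. \<psi> g (s (\<phi> (inv g) y)))"
    using continuous_map_compose [OF _ total.continuous_action,
        of "subtopology X U" "\<lambda>y. (g, s (\<phi> (inv g) y))"] g'
    by (simp add: o_def continuous_map_pairedI base.topspace_eq)
  then have "continuous_map (subtopology X U) E (section_act G \<phi> \<psi> U g s)"
    by (rule continuous_map_eq) (use g topU in \<open>auto simp: section_act_apply\<close>)
  moreover have "p (section_act G \<phi> \<psi> U g s y) = y" if y: "y \<in> U" for y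
  proof -
    have x: "\<phi> (inv g) y \<in> U"
      using ig y by blast
    have "\<phi> g (\<phi> (inv g) y) = y"
      using base.orbit_sym_aux [OF ig(1) _ refl, of y] g' y U by auto
    then show ?thesis
      using g g' y x sE s' by (simp add: section_act_apply equivariant)
  qed
  ultimately show ?thesis
    using g' by (simp add: sections_def section_act_def)
qed

text \<open>The action laws hold pointwise on \<open>U\<close>, and extensionality makes them
  equalities of sections.\<close>

lemma group_action_sections:
  assumes U: "U \<subseteq> topspace X"
  shows "group_action (G\<lparr>carrier := setwise_stabilizer G \<phi> U\<rparr>) (sections X E p U)
    (\<lambda>g. \<lambda>s \<in> sections X E p U. section_act G \<phi> \<psi> U g s)"
proof -
  let ?H = "setwise_stabilizer G \<phi> U" and ?F = "sections X E p U"
  have H: "subgroup ?H G"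
    using U by (rule base.subgroup_setwise_stabilizer)
  interpret H: group "G\<lparr>carrier := ?H\<rparr>"
    using H base.is_group by (rule subgroup.subgroup_is_group)
  have sE: "s x \<in> topspace E" if "s \<in> ?F" "x \<in> U" for s x
    using that U by (auto simp: sections_def continuous_map_def)
  have HG: "g \<in> carrier G" if "g \<in> ?H" for g
    using that by (simp add: setwise_stabilizer_def)
  have HU: "\<phi> g x \<in> U" if "g \<in> ?H" "x \<in> U" for g x
    using that by (auto simp: setwise_stabilizer_def)
  have H_inv: "inv g \<in> ?H" if "g \<in> ?H" for g
    using H that by (rule subgroup.m_inv_closed)
  have H_mult: "g \<otimes> h \<in> ?H" if "g \<in> ?H" "h \<in> ?H" for g h
    using H that by (rule subgroup.m_closed)
  have ext: "section_act G \<phi> \<psi> U g s \<in> extensional U" if "g \<in> ?H" for g s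
    using that by (simp add: section_act_def setwise_stabilizer_def)
  have one: "section_act G \<phi> \<psi> U \<one> s = s" if s: "s \<in> ?F" for s
  proof (rule extensionalityI [where A = U])
    fix x assume "x \<in> U"
    moreover from this have "\<phi> \<one> x = x" "\<psi> \<one> (s x) = s x"
      using U sE [OF s] by (auto simp: base.id_eq_one [symmetric] total.id_eq_one [symmetric])
    ultimately show "section_act G \<phi> \<psi> U \<one> s x = s x"
      using subgroup.one_closed [OF H] by (simp add: section_act_apply)
  qed (use s subgroup.one_closed [OF H] in \<open>auto simp: ext sections_def\<close>)
  have mult: "section_act G \<phi> \<psi> U (g \<otimes> h) s = section_act G \<phi> \<psi> U g (section_act G \<phi> \<psi> U h s)"
    if g: "g \<in> ?H" and h: "h \<in> ?H" and s: "s \<in> ?F" for g h s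
  proof (rule extensionalityI [where A = U])
    fix y assume y: "y \<in> U"
    \<comment> \<open>Inversion reverses the product, which is the order in which the two nested
      actions apply their inverses to \<open>y\<close>.\<close>
    have "\<phi> (inv (g \<otimes> h)) y = \<phi> (inv h) (\<phi> (inv g) y)"
      using U y HG [OF g] HG [OF h] by (auto simp: base.inv_mult_group base.composition_rule)
    moreover have "s (\<phi> (inv h) (\<phi> (inv g) y)) \<in> topspace E"
      using s y g h by (intro sE HU H_inv)
    ultimately show "section_act G \<phi> \<psi> U (g \<otimes> h) s y =
        section_act G \<phi> \<psi> U g (section_act G \<phi> \<psi> U h s) y"
      using g h y by (simp add: section_act_apply H_mult H_inv HU HG total.composition_rule)
  qed (use g h in \<open>auto simp: ext H_mult\<close>)
  show ?thesis
    by (rule H.group_actionI) (use U in \<open>auto simp: section_act_in_sections one mult\<close>)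
qed

lemma openin_section_act_eq:
  assumes U: "compactin X U" and s: "s \<in> sections X E p U" and t: "t \<in> sections X E p U"
  shows "openin (subtopology T (setwise_stabilizer G \<phi> U))
    {g \<in> setwise_stabilizer G \<phi> U. section_act G \<phi> \<psi> U g s = t}"
proof -
  let ?H = "setwise_stabilizer G \<phi> U"
  let ?TH = "subtopology T ?H" and ?XU = "subtopology X U"
  have UX: "U \<subseteq> topspace X"
    using U by (rule compactin_subset_topspace)
  have HG: "?H \<subseteq> carrier G"
    by (auto simp: setwise_stabilizer_def)
  have topH: "topspace ?TH = ?H" and topU: "topspace ?XU = U"
    using HG UX base.topspace_eq by auto
  have HU: "\<phi> g x \<in> U" if "g \<in> ?H" "x \<in> U" for g x
    using that by (auto simp: setwise_stabilizer_def)
  have s': "continuous_map ?XU E s" "\<And>x. x \<in> U \<Longrightarrow> p (s x) = x"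
    and t': "continuous_map ?XU E t" "\<And>x. x \<in> U \<Longrightarrow> p (t x) = x"
    using s t by (auto simp: sections_def)
  have sE: "s x \<in> topspace E" if "x \<in> U" for x
    using s'(1) that topU by (auto simp: continuous_map_def)
  let ?a = "\<lambda>(g, x). \<psi> g (s x)" and ?b = "\<lambda>(g, x). t (\<phi> g x)"
  have "continuous_map (prod_topology ?TH ?XU) (prod_topology T E) (\<lambda>z. (fst z, s (snd z)))"
    using continuous_map_compose [OF continuous_map_snd s'(1), of ?TH]
    by (intro continuous_map_pairedI)
       (auto simp: o_def intro: continuous_map_into_fulltopology continuous_map_fst)
  from continuous_map_compose [OF this total.continuous_action]
  have a: "continuous_map (prod_topology ?TH ?XU) E ?a"
    by (simp add: o_def case_prod_unfold)
  have "continuous_map (prod_topology ?TH ?XU) X (\<lambda>(g, x). \<phi> g x)"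
    by (simp add: subtopology_Times [symmetric] continuous_map_from_subtopology
        base.continuous_action)
  \<comment> \<open>The codomain is narrowed to \<open>U\<close> because \<open>t\<close> is
    continuous only there; elements of the stabilizer keep \<open>U\<close> invariant.\<close>
  then have "continuous_map (prod_topology ?TH ?XU) ?XU (\<lambda>(g, x). \<phi> g x)"
    using HU by (auto intro!: continuous_map_into_subtopology)
  from continuous_map_compose [OF this t'(1)]
  have b: "continuous_map (prod_topology ?TH ?XU) E ?b"
    by (simp add: o_def case_prod_unfold)
  \<comment> \<open>Both maps lie over g x: p(g s(x)) = g p(s(x)) = g x by equivariance, and p(t(g
    x)) = g x because g x is in \<open>U\<close>.\<close>
  have "openin (prod_topology ?TH ?XU) {z \<in> topspace (prod_topology ?TH ?XU). ?a z = ?b z}"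
    by (rule openin_lifts_agree [OF local_homeo a b])
       (use HG topH topU HU s' t' sE in \<open>auto simp: equivariant subset_iff\<close>)
  moreover have "compactin ?XU U"
    using U by (simp add: compactin_subtopology)
  ultimately have "openin ?TH {g \<in> topspace ?TH.
      \<forall>x\<in>U. (g, x) \<in> {z \<in> topspace (prod_topology ?TH ?XU). ?a z = ?b z}}"
    by (rule openin_Ball_compactin)
  also have "{g \<in> topspace ?TH. \<forall>x\<in>U. (g, x) \<in> {z \<in> topspace (prod_topology ?TH ?XU). ?a z = ?b z}}
      = {g \<in> ?H. \<forall>x\<in>U. \<psi> g (s x) = t (\<phi> g x)}"
    using topH topU by auto
  also have "\<dots> = {g \<in> ?H. section_act G \<phi> \<psi> U g s = t}"
  proof (intro Collect_cong conj_cong refl)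
    fix g assume g: "g \<in> ?H"
    then have g': "g \<in> carrier G" "\<phi> g ` U = U"
      by (auto simp: setwise_stabilizer_def)
    have inv: "\<phi> (inv g) (\<phi> g x) = x" if "x \<in> U" for x
      using base.orbit_sym_aux [OF g'(1) _ refl] that UX by blast
    have "section_act G \<phi> \<psi> U g s \<in> extensional U" "t \<in> extensional U"
      using g' t by (auto simp: section_act_def sections_def)
    then have "section_act G \<phi> \<psi> U g s = t \<longleftrightarrow> (\<forall>y\<in>\<phi> g ` U. section_act G \<phi> \<psi> U g s y = t y)"
      using g' by (metis extensionalityI)
    also have "\<dots> \<longleftrightarrow> (\<forall>x\<in>U. \<psi> g (s x) = t (\<phi> g x))"
      using g inv HU by (simp add: section_act_apply)
    finally show "(\<forall>x\<in>U. \<psi> g (s x) = t (\<phi> g x)) \<longleftrightarrow> section_act G \<phi> \<psi> U g s = t"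
      by simp
  qed
  finally show ?thesis .
qed

end

theorem corollary1:
  fixes G :: "('g, 'm) monoid_scheme" and T :: "'g topology"
    and X :: "'x topology" and \<phi> :: "'g \<Rightarrow> 'x \<Rightarrow> 'x"
    and E :: "'e topology" and \<psi> :: "'g \<Rightarrow> 'e \<Rightarrow> 'e"
    and p :: "'e \<Rightarrow> 'x" and U :: "'x set"
  assumes "profinite_group G T"
    and "profinite_space X" and "G_space G T X \<phi>"
    and "equivariant_sheaf G T X \<phi> E \<psi> p"
    and "openin X U" and "compactin X U"
  shows "discrete_G_set (G\<lparr>carrier := setwise_stabilizer G \<phi> U\<rparr>)
           (subtopology T (setwise_stabilizer G \<phi> U))
           (sections X E p U)
           (\<lambda>g. \<lambda>s \<in> sections X E p U. section_act G \<phi> \<psi> U g s)"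
proof -
  interpret equivariant_sheaf G T X \<phi> E \<psi> p by fact
  have U: "U \<subseteq> topspace X"
    using \<open>openin X U\<close> by (rule openin_subset)
  show ?thesis
  proof (rule discrete_G_setI)
    show "topological_group (G\<lparr>carrier := setwise_stabilizer G \<phi> U\<rparr>)
        (subtopology T (setwise_stabilizer G \<phi> U))"
      using base.subgroup_setwise_stabilizer [OF U] by (rule base.topological_group_subgroup)
  \<comment> \<open>On members of \<open>sections X E p U\<close> the restricted lambda reduces to
    \<open>section_act\<close>, so the required open fibres are those of
    \<open>openin_section_act_eq\<close>.\<close>
  qed (use U \<open>compactin X U\<close> in \<open>simp_all add: group_action_sections openin_section_act_eq\<close>)
qed

end
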